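(* For $x\in[0,2]$ consider the lower-level problem $$\min_{y\in\mathbb R^2}\ g(x,y)=(y_1-x)^2+y_2^2\quad\text{s.t.}\quad \|y\|^2-1\le 0.$$ There exist a compact set $K\subset\mathbb R^2$ whose interior contains the closed unit disk and $\epsilon>0$ such that the following holds: for any $C^2$ functions $s,r:[0,2]\times\mathbb R^2\to\mathbb R$ such that $|s|,\|\nabla_y s\|,\|\nabla^2_{yy}s\|_{\rm op},|r|,\|\nabla_y r\|,\|\nabla^2_{yy}r\|_{\rm op}$ are all at most $\epsilon$ at every $(x,y)\in[0,2]\times K$, the perturbed problem $$\min_{y\in\mathbb R^2}\ \widetilde g(x,y)=(y_1-x)^2+y_2^2+s(x,y)\quad\text{s.t.}\quad \widetilde h(x,y)=\|y\|^2-1+r(x,y)\le 0$$ has the property that there exist $x^\ast\in[0,2]$ and a KKT point $y^\ast\in\mathbb R^2$ of the perturbed problem at $x^\ast$ at which SCSC fails.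
   Context: KKT pair of the perturbed problem at $x$: $(y,\lambda)\in\mathbb R^2\times\mathbb R$ with $\nabla_y\widetilde g(x,y)+\lambda\nabla_y\widetilde h(x,y)=0$, $\widetilde h(x,y)\le 0$, $\lambda\ge 0$, $\lambda\widetilde h(x,y)=0$; $y$ is then a KKT point. SCSC (strict complementary slackness) holds at the KKT pair $(y,\lambda)$ if either $\widetilde h(x,y)<0$ and $\lambda=0$, or $\widetilde h(x,y)=0$ and $\lambda>0$; it fails if $\widetilde h(x,y)=0$ and $\lambda=0$. *)

theory Defs
  imports "HOL-Analysis.Analysis"
begin

(* Twice continuously differentiable on S. At boundary points of S the derivatives are taken
   within S; for S = {0..2} \<times> UNIV they are unique, and one-sided in x at x = 0 and x = 2. *)
definition C2_on :: "('a::real_normed_vector \<Rightarrow> real) \<Rightarrow> 'a set \<Rightarrow> bool" where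
  "C2_on f S \<longleftrightarrow>
     (\<exists>(f' :: 'a \<Rightarrow> 'a \<Rightarrow>\<^sub>L real) (f'' :: 'a \<Rightarrow> 'a \<Rightarrow>\<^sub>L ('a \<Rightarrow>\<^sub>L real)).
        (\<forall>z\<in>S. (f has_derivative blinfun_apply (f' z)) (at z within S)) \<and>
        (\<forall>z\<in>S. (f' has_derivative blinfun_apply (f'' z)) (at z within S)) \<and>
        continuous_on S f'')"

(* Only meaningful where f is differentiable; the gradient is then unique (see grad_eq). *)
definition grad :: "('a::real_inner \<Rightarrow> real) \<Rightarrow> 'a \<Rightarrow> 'a" where
  "grad f y = (THE D. GDERIV f y :> D)"

(* The Hessian as a linear map, so that its operator norm is onorm (hessian f y). *)
definition hessian :: "('a::real_inner \<Rightarrow> real) \<Rightarrow> 'a \<Rightarrow> 'a \<Rightarrow> 'a" where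
  "hessian f y = frechet_derivative (grad f) (at y)"

lemma grad_eq:
  assumes "GDERIV f y :> D"
  shows "grad f y = D"
  unfolding grad_def
proof (rule the_equality)
  show "GDERIV f y :> D" by fact
  fix E assume "GDERIV f y :> E"
  then have "(\<lambda>h. h \<bullet> E) = (\<lambda>h. h \<bullet> D)"
    using has_derivative_unique[of f "\<lambda>h. h \<bullet> E" y "\<lambda>h. h \<bullet> D"] assms
    by (simp only: gderiv_def)
  then have "\<forall>h. h \<bullet> E = h \<bullet> D" by (simp add: fun_eq_iff)
  then show "E = D" by (simp only: vector_eq_ldot)
qed

definition lower_obj :: "real \<Rightarrow> real^2 \<Rightarrow> real" where
  "lower_obj x y = (y $ 1 - x)\<^sup>2 + (y $ 2)\<^sup>2"

definition lower_con :: "real^2 \<Rightarrow> real" where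
  "lower_con y = (norm y)\<^sup>2 - 1"

definition perturbed_obj :: "(real \<times> (real^2) \<Rightarrow> real) \<Rightarrow> real \<Rightarrow> real^2 \<Rightarrow> real" where
  "perturbed_obj s x y = lower_obj x y + s (x, y)"

definition perturbed_con :: "(real \<times> (real^2) \<Rightarrow> real) \<Rightarrow> real \<Rightarrow> real^2 \<Rightarrow> real" where
  "perturbed_con r x y = lower_con y + r (x, y)"

(* KKT pairs of: minimise g y subject to h y \<le> 0 *)
definition KKT_pair ::
    "('a::real_inner \<Rightarrow> real) \<Rightarrow> ('a \<Rightarrow> real) \<Rightarrow> 'a \<Rightarrow> real \<Rightarrow> bool" where
  "KKT_pair g h y l \<longleftrightarrow>
     grad g y + l *\<^sub>R grad h y = 0 \<and> h y \<le> 0 \<and> l \<ge> 0 \<and> l * h y = 0"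

definition SCSC :: "('a \<Rightarrow> real) \<Rightarrow> 'a \<Rightarrow> real \<Rightarrow> bool" where
  "SCSC h y l \<longleftrightarrow> (h y < 0 \<and> l = 0) \<or> (h y = 0 \<and> l > 0)"

definition C2_small :: "real \<Rightarrow> (real^2) set \<Rightarrow> (real \<times> (real^2) \<Rightarrow> real) \<Rightarrow> bool" where
  "C2_small \<epsilon> K p \<longleftrightarrow>
     (\<forall>x\<in>{0..2}. \<forall>y\<in>K.
        \<bar>p (x, y)\<bar> \<le> \<epsilon> \<and>
        norm (grad (\<lambda>y. p (x, y)) y) \<le> \<epsilon> \<and>
        onorm (hessian (\<lambda>y. p (x, y)) y) \<le> \<epsilon>)"

end

(* A multiplier 0 reduces the claim to finding x in [0,2] and y with \<nabla>_y g~(x,y) = 0 and h~(x,y) = 0.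
   Writing e for the first unit vector, these are the fixed points of
   (x, y) \<mapsto> (clamp (x - h~(x,y)), x e - \<nabla>_y s(x,y) / 2), a continuous self-map of
   [0,2] \<times> cball 0 3 to which Brouwer's theorem applies. The clamp is inactive at a fixed point:
   there y is close to x e, so h~ < 0 if x = 0 and h~ > 0 if x = 2, and the clamped coordinate
   would move inwards. *)

theory Submission
  imports Defs
begin

lemma C2_on_imp_continuous_on:
  assumes "C2_on f S"
  shows "continuous_on S f"
proof -
  from assms obtain f' where
    "\<And>z. z \<in> S \<Longrightarrow> (f has_derivative blinfun_apply (f' z)) (at z within S)"
    unfolding C2_on_def by metis
  then show ?thesis by (rule has_derivative_continuous_on)
qed

text \<open>Brouwer's theorem needs the gradient in the second variable to be continuous in both
  variables jointly, including where the first one lies on the boundary of \<open>A\<close>. This is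
  inherited from the joint derivative.\<close>

lemma C2_on_partial_gradient:
  fixes f :: "'b::real_normed_vector \<times> 'a::euclidean_space \<Rightarrow> real"
  assumes "C2_on f (A \<times> UNIV)"
  obtains G where "continuous_on (A \<times> UNIV) G"
    and "\<And>x y. x \<in> A \<Longrightarrow> GDERIV (\<lambda>y. f (x, y)) y :> G (x, y)"
proof -
  from assms obtain f' f'' where
    f': "\<And>z. z \<in> A \<times> UNIV \<Longrightarrow> (f has_derivative blinfun_apply (f' z)) (at z within A \<times> UNIV)" and
    f'': "\<And>z. z \<in> A \<times> UNIV \<Longrightarrow> (f' has_derivative blinfun_apply (f'' z)) (at z within A \<times> UNIV)"
    unfolding C2_on_def by metis
  \<comment> \<open>The Riesz vector of the functional \<open>h\<close> \<mapsto>
    \<open>f' z (0, h)\<close>, in coordinates so that continuity follows from that of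
    \<open>f'\<close>.\<close>
  define G where "G z = (\<Sum>b\<in>Basis. blinfun_apply (f' z) (0, b) *\<^sub>R b)" for z
  have "continuous_on (A \<times> UNIV) f'"
    using f'' by (rule has_derivative_continuous_on)
  then have "continuous_on (A \<times> UNIV) G"
    unfolding G_def by (intro continuous_intros)
  moreover have "GDERIV (\<lambda>y. f (x, y)) y :> G (x, y)" if "x \<in> A" for x y
  proof -
    have pair: "((\<lambda>y. (x, y)) has_derivative (\<lambda>h. (0, h))) (at y within UNIV)"
      by (intro derivative_eq_intros) auto
    \<comment> \<open>The whole slice over \<open>x\<close> lies in \<open>A \<times> UNIV\<close>,
      so a derivative taken within that set still yields an unrestricted derivative in
      \<open>y\<close>.\<close>
    have "(f has_derivative blinfun_apply (f' (x, y))) (at (x, y) within range (Pair x))"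
      using that by (intro has_derivative_subset[OF f']) auto
    from has_derivative_in_compose[OF pair this]
    have der: "((\<lambda>y. f (x, y)) has_derivative (\<lambda>h. blinfun_apply (f' (x, y)) (0, h))) (at y)"
      by simp
    have "blinfun_apply (f' (x, y)) (0, h) = h \<bullet> G (x, y)" for h
    proof -
      have "linear (\<lambda>h. blinfun_apply (f' (x, y)) (0, h))"
        using der by (rule has_derivative_linear)
      from Linear_Algebra.linear_componentwise[OF this, of h 1]
      show ?thesis by (simp add: G_def inner_sum_right mult.commute)
    qed
    with der show ?thesis by (simp add: gderiv_def)
  qed
  ultimately show thesis by (rule that)
qed

lemma norm_axis_real: "norm (axis i x :: real^'n) = \<bar>x\<bar>"
  by (simp add: norm_eq_sqrt_inner inner_axis_axis)

lemma lower_obj_eq_norm: "lower_obj x y = (norm (y - axis 1 x))\<^sup>2"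
  unfolding lower_obj_def power2_norm_eq_inner
  by (simp add: inner_vec_def sum_2 axis_def power2_eq_square)

lemma GDERIV_lower_obj: "GDERIV (lower_obj x) y :> 2 *\<^sub>R (y - axis 1 x)"
  unfolding gderiv_def lower_obj_eq_norm[abs_def] power2_norm_eq_inner
  by (auto intro!: derivative_eq_intros simp: inner_commute algebra_simps)

lemma GDERIV_perturbed_obj:
  assumes "GDERIV (\<lambda>y. s (x, y)) y :> D"
  shows "GDERIV (perturbed_obj s x) y :> 2 *\<^sub>R (y - axis 1 x) + D"
  unfolding perturbed_obj_def[abs_def] by (intro GDERIV_add GDERIV_lower_obj assms)

lemma exists_degenerate_KKT:
  fixes s r :: "real \<times> (real^2) \<Rightarrow> real"
  assumes s: "C2_on s ({0..2} \<times> UNIV)" and r: "C2_on r ({0..2} \<times> UNIV)"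
    and s_small: "C2_small (1/2) (cball 0 3) s" and r_small: "C2_small (1/2) (cball 0 3) r"
  shows "\<exists>x\<in>{0..2}. \<exists>y. KKT_pair (perturbed_obj s x) (perturbed_con r x) y 0 \<and>
           perturbed_con r x y = 0"
proof -
  obtain G where contG: "continuous_on ({0..2} \<times> UNIV) G"
    and G: "\<And>x y. x \<in> {0..2} \<Longrightarrow> GDERIV (\<lambda>y. s (x, y)) y :> G (x, y)"
    by (rule C2_on_partial_gradient[OF s]) blast
  have contr: "continuous_on ({0..2} \<times> UNIV) r"
    using r by (rule C2_on_imp_continuous_on)
  have G_small: "norm (G (x, y)) \<le> 1/2" if "x \<in> {0..2}" "y \<in> cball 0 3" for x y
    using s_small that grad_eq[OF G] unfolding C2_small_def by metis
  have r_le: "\<bar>r (x, y)\<bar> \<le> 1/2" if "x \<in> {0..2}" "y \<in> cball 0 3" for x y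
    using r_small that unfolding C2_small_def by metis
  \<comment> \<open>Radius 3 suffices for a self-map: the second component of \<open>T\<close> has
    norm at most 2 + 1/4.\<close>
  define S :: "(real \<times> (real^2)) set" where "S = {0..2} \<times> cball 0 3"
  define T where "T z = (max 0 (min 2 (fst z - perturbed_con r (fst z) (snd z))),
      axis 1 (fst z) - (1/2) *\<^sub>R G z)" for z
  \<comment> \<open>Makes the dependence on \<open>t\<close> a scaling, to which the continuity
    rules apply.\<close>
  have axis: "axis 1 t = t *\<^sub>R (axis 1 1 :: real^2)" for t
    by (simp add: vec_eq_iff axis_def)
  have S_sub: "S \<subseteq> {0..2} \<times> UNIV" by (auto simp: S_def)
  have "continuous_on S T"
    unfolding T_def perturbed_con_def lower_con_def axis[of "fst _"] prod.collapse
    by (intro continuous_intros continuous_on_subset[OF contG S_sub]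
        continuous_on_subset[OF contr S_sub])
  moreover have "T z \<in> S" if zS: "z \<in> S" for z
  proof -
    obtain x y where z: "z = (x, y)" "x \<in> {0..2}" "y \<in> cball 0 3"
      using zS by (auto simp: S_def)
    have "norm (axis 1 x - (1/2) *\<^sub>R G (x, y)) \<le> norm (axis 1 x :: real^2) + norm ((1/2) *\<^sub>R G (x, y))"
      by (rule norm_triangle_ineq4)
    then show ?thesis using z G_small[of x y] by (simp add: S_def T_def norm_axis_real)
  qed
  moreover have "compact S" "convex S" "S \<noteq> {}"
    by (auto simp: S_def compact_Times convex_Times)
  ultimately obtain z where z: "z \<in> S" "T z = z"
    using brouwer[of S T] by blast
  obtain x y where xy: "z = (x, y)" "x \<in> {0..2}" "y \<in> cball 0 3"
    using z by (auto simp: S_def)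
  define h where "h = perturbed_con r x y"
  have x_fix: "max 0 (min 2 (x - h)) = x" and y_fix: "y = axis 1 x - (1/2) *\<^sub>R G (x, y)"
    using z(2) by (auto simp: T_def xy h_def)
  have near: "\<bar>norm y - x\<bar> \<le> 1/4"
  proof -
    have "\<bar>norm y - norm (axis 1 x :: real^2)\<bar> \<le> norm (y - axis 1 x)"
      by (rule norm_triangle_ineq3)
    also have "y - axis 1 x = - ((1/2) *\<^sub>R G (x, y))"
      \<comment> \<open>Only one occurrence is rewritten, since \<open>y\<close> reappears inside
        \<open>G (x, y)\<close>.\<close>
      by (subst (1) y_fix) simp
    finally show ?thesis using G_small[OF xy(2,3)] xy(2) by (simp add: norm_axis_real)
  qed
  have h_eq: "h = (norm y)\<^sup>2 - 1 + r (x, y)"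
    by (simp add: h_def perturbed_con_def lower_con_def)
  \<comment> \<open>Here \<open>h\<close> \<le> 1/16 - 1 + 1/2 < 0.\<close>
  have "h < 0" if "x = 0"
  proof -
    have "(norm y)\<^sup>2 \<le> (1/4)\<^sup>2" using near that by (intro power_mono) auto
    then show ?thesis using r_le[OF xy(2,3)] by (simp add: h_eq power2_eq_square)
  qed
  \<comment> \<open>Here \<open>h\<close> \<ge> 49/16 - 1 - 1/2 > 0.\<close>
  moreover have "h > 0" if "x = 2"
  proof -
    have "7/4 \<le> norm y" using near that by linarith
    then have "(7/4)\<^sup>2 \<le> (norm y)\<^sup>2" by (intro power_mono) auto
    then show ?thesis using r_le[OF xy(2,3)] by (simp add: h_eq power2_eq_square)
  qed
  \<comment> \<open>For nonzero \<open>h\<close>, the clamp can fix \<open>x\<close> only if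
    \<open>x = 0\<close> and \<open>h > 0\<close>, or \<open>x = 2\<close> and \<open>h < 0\<close>;
    the two sign facts exclude both.\<close>
  ultimately have "h = 0" using x_fix xy(2) by (auto simp: max_def min_def split: if_splits)
  moreover have "2 *\<^sub>R (y - axis 1 x) + G (x, y) = 0"
    by (subst (1) y_fix) (simp add: scaleR_diff_right)
  then have "grad (perturbed_obj s x) y = 0"
    using grad_eq[OF GDERIV_perturbed_obj[where s = s, OF G[OF xy(2), of y]]] by simp
  ultimately show ?thesis
    using xy(2) by (intro bexI[of _ x] exI[of _ y]) (simp_all add: KKT_pair_def h_def)
qed

theorem mainTheorem7:
  shows "\<exists>(K :: (real^2) set) \<epsilon> :: real.
    compact K \<and> cball 0 1 \<subseteq> interior K \<and> \<epsilon> > 0 \<and>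
    (\<forall>s r :: real \<times> (real^2) \<Rightarrow> real.
       C2_on s ({0..2} \<times> UNIV) \<longrightarrow> C2_on r ({0..2} \<times> UNIV) \<longrightarrow>
       C2_small \<epsilon> K s \<longrightarrow> C2_small \<epsilon> K r \<longrightarrow>
       (\<exists>x\<in>{0..2}. \<exists>y l.
          KKT_pair (perturbed_obj s x) (perturbed_con r x) y l \<and>
          \<not> SCSC (perturbed_con r x) y l))"
proof (intro exI[of _ "cball 0 3"] exI[of _ "1/2 :: real"] conjI allI impI)
  show "compact (cball (0 :: real^2) 3)" by simp
  show "cball (0 :: real^2) 1 \<subseteq> interior (cball 0 3)" by auto
  show "(1/2 :: real) > 0" by simp
  fix s r :: "real \<times> (real^2) \<Rightarrow> real"
  assume "C2_on s ({0..2} \<times> UNIV)" "C2_on r ({0..2} \<times> UNIV)"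
    "C2_small (1/2) (cball 0 3) s" "C2_small (1/2) (cball 0 3) r"
  from exists_degenerate_KKT[OF this]
  show "\<exists>x\<in>{0..2}. \<exists>y l. KKT_pair (perturbed_obj s x) (perturbed_con r x) y l \<and>
      \<not> SCSC (perturbed_con r x) y l"
    \<comment> \<open>With constraint value and multiplier both 0, either alternative of
      \<open>SCSC\<close> would give 0 < 0.\<close>
    unfolding SCSC_def by (metis less_irrefl)
qed

end
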